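(* Let $\mathfrak{G}$ be a finite class of graphs over a finite vertex set and let $\mathcal{M}$ be a map assigning to each $\mathcal{G}\in\mathfrak{G}$ a set (model) $\mathcal{M}(\mathcal{G})$, such that $\mathcal{M}$ is injective ($\mathcal{G}\neq\mathcal{G}'$ implies $\mathcal{M}(\mathcal{G})\neq\mathcal{M}(\mathcal{G}')$). Let $\mathcal{L}=(\mathfrak{G},\preceq)$ be the poset with $\mathcal{G}_1\preceq\mathcal{G}_2$ if and only if $\mathcal{M}(\mathcal{G}_1)\subseteq\mathcal{M}(\mathcal{G}_2)$. (a) If $\mathcal{L}$ has a least element, then $\mathcal{L}$ is lower semimodular if and only if $d_{\mathcal{L},\downarrow\uparrow}(\mathcal{G}_s,\mathcal{G}_t)=d_{\mathcal{L}}(\mathcal{G}_s,\mathcal{G}_t)$ for every $\mathcal{G}_s,\mathcal{G}_t\in\mathfrak{G}$. (b) If $\mathcal{L}$ has a greatest element, then $\mathcal{L}$ is upper semimodular if and only if $d_{\mathcal{L},\uparrow\downarrow}(\mathcal{G}_s,\mathcal{G}_t)=d_{\mathcal{L}}(\mathcal{G}_s,\mathcal{G}_t)$ for every $\mathcal{G}_s,\mathcal{G}_t\in\mathfrak{G}$.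
   Context: In a poset, $y$ covers $x$ (written $x\lessdot y$ or $y\gtrdot x$) if $x\prec y$ and there is no $z$ with $x\prec z\prec y$. The Hasse diagram has an edge between $x$ and $y$ whenever one covers the other. A path of length $d$ between $\mathcal{G}_s$ and $\mathcal{G}_t$ is a sequence $(\mathcal{G}_0,\dots,\mathcal{G}_d)$ with $\mathcal{G}_0=\mathcal{G}_s$, $\mathcal{G}_d=\mathcal{G}_t$ and, for each $i$, $\mathcal{G}_{i-1}\lessdot\mathcal{G}_i$ or $\mathcal{G}_{i-1}\gtrdot\mathcal{G}_i$. The model-oriented distance $d_{\mathcal{L}}(\mathcal{G}_s,\mathcal{G}_t)$ is the minimum length of a path between $\mathcal{G}_s$ and $\mathcal{G}_t$. A path is down-up if it has the form $\mathcal{G}_s=x_0\gtrdot\cdots\gtrdot x_{i^*}\lessdot\cdots\lessdot x_d=\mathcal{G}_t$ for some $i^*\in\{0,\dots,d\}$, and up-down if it has the form $\mathcal{G}_s=x_0\lessdot\cdots\lessdot x_{i^*}\gtrdot\cdots\gtrdot x_d=\mathcal{G}_t$. The down-up distance $d_{\mathcal{L},\downarrow\uparrow}$ (defined when there is a least element) and the up-down distance $d_{\mathcal{L},\uparrow\downarrow}$ (defined when there is a greatest element) are the minimum lengths of a down-up, respectively up-down, path. $\mathcal{L}$ is lower semimodular if for all $\mathcal{G}_s,\mathcal{G}_t,\mathcal{G}$ with $\mathcal{G}\gtrdot\mathcal{G}_s$, $\mathcal{G}\gtrdot\mathcal{G}_t$ and $\mathcal{G}_s\neq\mathcal{G}_t$,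 there exists $\mathcal{G}'$ with $\mathcal{G}_s\gtrdot\mathcal{G}'$ and $\mathcal{G}_t\gtrdot\mathcal{G}'$. It is upper semimodular if the same holds with $\gtrdot$ replaced by $\lessdot$ throughout. *)

theory Defs
  imports "HOL-Algebra.Order" "HOL-Library.Extended_Nat"
begin

text \<open>
  Directed, undirected, bidirected or partially oriented edges are told apart by the label of an
  edge. The type \<open>'k\<close> of labels is arbitrary, so that this covers mixed graphs of every kind; which
  label sets, symmetry or acyclicity conditions are imposed is left to the class of graphs.
\<close>

record ('v, 'k) lgraph =
  verts :: "'v set"
  edges :: "('v \<times> 'k \<times> 'v) set"

definition graph_over :: "'v set \<Rightarrow> ('v, 'k) lgraph \<Rightarrow> bool" where
  "graph_over V G \<longleftrightarrow> verts G = V \<and> edges G \<subseteq> V \<times> UNIV \<times> V"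

definition model_poset :: "'g set \<Rightarrow> ('g \<Rightarrow> 'm set) \<Rightarrow> 'g gorder" where
  "model_poset \<GG> M = \<lparr>carrier = \<GG>, eq = (=), le = (\<lambda>G1 G2. M G1 \<subseteq> M G2)\<rparr>"

lemma partial_order_model_poset:
  assumes "inj_on M \<GG>"
  shows "partial_order (model_poset \<GG> M)"
  by unfold_locales (use assms in \<open>auto simp: model_poset_def dest: inj_onD\<close>)

text \<open>The order of arguments follows the order relation: the second argument covers the first.\<close>

definition covered_by :: "('g, 'b) gorder_scheme \<Rightarrow> 'g \<Rightarrow> 'g \<Rightarrow> bool" where
  "covered_by L x y \<longleftrightarrow>
     x \<in> carrier L \<and> y \<in> carrier L \<and> x \<sqsubset>\<^bsub>L\<^esub> y \<and>
     \<not> (\<exists>z \<in> carrier L. x \<sqsubset>\<^bsub>L\<^esub> z \<and> z \<sqsubset>\<^bsub>L\<^esub> y)"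

text \<open>A path \<open>(x\<^sub>0, \<dots>, x\<^sub>d)\<close> is a list of \<open>d + 1\<close> elements; its length as a path is \<open>d\<close>.\<close>

definition path_length :: "'g list \<Rightarrow> nat" where
  "path_length p = length p - 1"

definition hasse_path :: "('g, 'b) gorder_scheme \<Rightarrow> 'g \<Rightarrow> 'g \<Rightarrow> 'g list \<Rightarrow> bool" where
  "hasse_path L s t p \<longleftrightarrow>
     p \<noteq> [] \<and> set p \<subseteq> carrier L \<and> hd p = s \<and> last p = t \<and>
     (\<forall>j < path_length p. covered_by L (p ! j) (p ! Suc j) \<or> covered_by L (p ! Suc j) (p ! j))"

definition down_up_path :: "('g, 'b) gorder_scheme \<Rightarrow> 'g \<Rightarrow> 'g \<Rightarrow> 'g list \<Rightarrow> bool" where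
  "down_up_path L s t p \<longleftrightarrow>
     hasse_path L s t p \<and>
     (\<exists>i \<le> path_length p.
        (\<forall>j < i. covered_by L (p ! Suc j) (p ! j)) \<and>
        (\<forall>j \<in> {i..<path_length p}. covered_by L (p ! j) (p ! Suc j)))"

definition up_down_path :: "('g, 'b) gorder_scheme \<Rightarrow> 'g \<Rightarrow> 'g \<Rightarrow> 'g list \<Rightarrow> bool" where
  "up_down_path L s t p \<longleftrightarrow>
     hasse_path L s t p \<and>
     (\<exists>i \<le> path_length p.
        (\<forall>j < i. covered_by L (p ! j) (p ! Suc j)) \<and>
        (\<forall>j \<in> {i..<path_length p}. covered_by L (p ! Suc j) (p ! j)))"

text \<open>
  The distances take values in \<open>enat\<close>: the infimum is the minimum length if there is a path of the
  required kind, and \<open>\<infinity>\<close> if there is none.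
\<close>

definition poset_dist :: "('g, 'b) gorder_scheme \<Rightarrow> 'g \<Rightarrow> 'g \<Rightarrow> enat" where
  "poset_dist L s t = (INF p \<in> {p. hasse_path L s t p}. enat (path_length p))"

definition down_up_dist :: "('g, 'b) gorder_scheme \<Rightarrow> 'g \<Rightarrow> 'g \<Rightarrow> enat" where
  "down_up_dist L s t = (INF p \<in> {p. down_up_path L s t p}. enat (path_length p))"

definition up_down_dist :: "('g, 'b) gorder_scheme \<Rightarrow> 'g \<Rightarrow> 'g \<Rightarrow> enat" where
  "up_down_dist L s t = (INF p \<in> {p. up_down_path L s t p}. enat (path_length p))"

definition lower_semimodular :: "('g, 'b) gorder_scheme \<Rightarrow> bool" where
  "lower_semimodular L \<longleftrightarrow>
     (\<forall>s \<in> carrier L. \<forall>t \<in> carrier L. \<forall>x \<in> carrier L.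
        covered_by L s x \<and> covered_by L t x \<and> s \<noteq> t \<longrightarrow>
        (\<exists>y \<in> carrier L. covered_by L y s \<and> covered_by L y t))"

definition upper_semimodular :: "('g, 'b) gorder_scheme \<Rightarrow> bool" where
  "upper_semimodular L \<longleftrightarrow>
     (\<forall>s \<in> carrier L. \<forall>t \<in> carrier L. \<forall>x \<in> carrier L.
        covered_by L x s \<and> covered_by L x t \<and> s \<noteq> t \<longrightarrow>
        (\<exists>y \<in> carrier L. covered_by L s y \<and> covered_by L t y))"

end

theory Submission
  imports Defs
begin

text \<open>
  Both equivalences come from exchanging a peak for a valley. In a lower semimodular poset a peak
  \<open>s \<lessdot> x \<gtrdot> t\<close> on a path can be replaced by a valley \<open>s \<gtrdot> y \<lessdot> t\<close>, or removed if \<open>s = t\<close>, without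
  making the path longer; pushing all the ascents to the end turns any path into a down-up path that
  is at most as long. Conversely, a peak with \<open>s \<noteq> t\<close> gives \<open>d(s, t) \<le> 2\<close>, and the only down-up path
  of length at most 2 that is compatible with the two covering relations is a valley.
\<close>

text \<open>As a relation, coverings can be composed and iterated: \<open>^^ n\<close> stands for n
  ascents, and the converse gives descents.\<close>

abbreviation coverings :: "('g, 'b) gorder_scheme \<Rightarrow> ('g \<times> 'g) set" where
  "coverings L \<equiv> {(x, y). covered_by L x y}"

section \<open>Rearranging ascents and descents\<close>

lemma relpow_converse: "((R :: ('a \<times> 'a) set)\<inverse>) ^^ n = (R ^^ n)\<inverse>"
  by (induction n) (simp_all add: converse_relcomp flip: relpow_commute)

text \<open>\<open>exchange\<close> is lower semimodularity for relations: a peak is degenerate or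
  can be replaced by a valley. The ascent moves right past one descent after another, each exchange
  preserving the number of steps, until it reaches the end or cancels against a descent.\<close>

lemma push_ascent:
  assumes exchange: "C O C\<inverse> \<subseteq> Id \<union> C\<inverse> O C"
    and "(s, x) \<in> C" and "(x, y) \<in> C\<inverse> ^^ i"
  shows "\<exists>k l. k + l \<le> Suc i \<and> (s, y) \<in> C\<inverse> ^^ k O C ^^ l"
  using assms(2,3)
proof (induction i arbitrary: s x)
  case 0
  then have "(s, y) \<in> C\<inverse> ^^ 0 O C ^^ 1" by auto
  then show ?case by (intro exI[of _ 0] exI[of _ 1]) simp
next
  case (Suc i)
  from Suc.prems(2) obtain x' where x': "(x, x') \<in> C\<inverse>" "(x', y) \<in> C\<inverse> ^^ i"
    by (rule relpow_Suc_E2)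
  show ?case
  proof (cases "s = x'")
    case True
    \<comment> \<open>The degenerate peak is dropped; the remaining \<open>i\<close> descents
      already start at \<open>s\<close>.\<close>
    then have "(s, y) \<in> C\<inverse> ^^ i O C ^^ 0" using x' by auto
    then show ?thesis by (intro exI[of _ i] exI[of _ 0]) simp
  next
    case False
    with exchange Suc.prems(1) x'(1) have "(s, x') \<in> C\<inverse> O C" by blast
    then obtain z where z: "(s, z) \<in> C\<inverse>" "(z, x') \<in> C" by auto
    from Suc.IH[OF z(2) x'(2)] obtain k l where
      kl: "k + l \<le> Suc i" "(z, y) \<in> C\<inverse> ^^ k O C ^^ l" by blast
    have "(s, y) \<in> C\<inverse> ^^ Suc k O C ^^ l"
      using kl(2) z(1) by (auto intro: relpow_Suc_I2 simp del: relpow.simps)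
    with kl(1) show ?thesis by (intro exI[of _ "Suc k"] exI[of _ l]) simp
  qed
qed

text \<open>Induction on the first step, with the rest already rearranged: a descent prolongs the
  descending part, while an ascent is pushed through it, and what is left of it joins the final
  ascents.\<close>

lemma relpow_symcl_imp_down_up:
  assumes exchange: "C O C\<inverse> \<subseteq> Id \<union> C\<inverse> O C"
    and "(s, t) \<in> (C \<union> C\<inverse>) ^^ n"
  shows "\<exists>i j. i + j \<le> n \<and> (s, t) \<in> C\<inverse> ^^ i O C ^^ j"
  using assms(2)
proof (induction n arbitrary: s)
  case 0
  then show ?case by auto
next
  case (Suc n)
  from Suc.prems obtain x where x: "(s, x) \<in> C \<union> C\<inverse>" "(x, t) \<in> (C \<union> C\<inverse>) ^^ n"
    by (rule relpow_Suc_E2)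
  from Suc.IH[OF x(2)] obtain i j y where
    ij: "i + j \<le> n" "(x, y) \<in> C\<inverse> ^^ i" "(y, t) \<in> C ^^ j" by blast
  from x(1) show ?case
  proof
    assume "(s, x) \<in> C"
    from push_ascent[OF exchange this ij(2)] obtain k l z where
      kl: "k + l \<le> Suc i" "(s, z) \<in> C\<inverse> ^^ k" "(z, y) \<in> C ^^ l" by blast
    have "(z, t) \<in> C ^^ (l + j)" using kl(3) ij(3) by (auto simp: relpow_add)
    then have "(s, t) \<in> C\<inverse> ^^ k O C ^^ (l + j)" using kl(2) by blast
    then show ?thesis using kl(1) ij(1) by (intro exI[of _ k] exI[of _ "l + j"]) simp
  next
    assume "(s, x) \<in> C\<inverse>"
    then have "(s, y) \<in> C\<inverse> ^^ Suc i" using ij(2) by (rule relpow_Suc_I2)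
    then have "(s, t) \<in> C\<inverse> ^^ Suc i O C ^^ j" using ij(3) by blast
    then show ?thesis using ij(1) by (intro exI[of _ "Suc i"] exI[of _ j]) simp
  qed
qed

section \<open>Paths as relation powers\<close>

lemma hasse_path_imp_relpow:
  assumes "hasse_path L s t p"
  shows "(s, t) \<in> (coverings L \<union> (coverings L)\<inverse>) ^^ path_length p"
  unfolding relpow_fun_conv using assms
  by (intro exI[of _ "\<lambda>k. p ! k"])
    (auto simp: hasse_path_def path_length_def hd_conv_nth last_conv_nth)

lemma down_up_path_imp_relpow:
  assumes "down_up_path L s t p"
  shows "\<exists>i j. i + j = path_length p \<and> (s, t) \<in> (coverings L)\<inverse> ^^ i O coverings L ^^ j"
proof -
  from assms obtain i where p: "hasse_path L s t p" and i: "i \<le> path_length p"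
    and down: "\<forall>j < i. covered_by L (p ! Suc j) (p ! j)"
    and up: "\<forall>j \<in> {i..<path_length p}. covered_by L (p ! j) (p ! Suc j)"
    unfolding down_up_path_def by blast
  have st: "s = p ! 0" "t = p ! path_length p"
    using p by (auto simp: hasse_path_def path_length_def hd_conv_nth last_conv_nth)
  have "(s, p ! i) \<in> (coverings L)\<inverse> ^^ i"
    unfolding relpow_fun_conv using down st by (intro exI[of _ "\<lambda>k. p ! k"]) auto
  moreover have "(p ! i, t) \<in> coverings L ^^ (path_length p - i)"
    unfolding relpow_fun_conv using up st i by (intro exI[of _ "\<lambda>k. p ! (i + k)"]) auto
  ultimately show ?thesis using i
    by (intro exI[of _ i] exI[of _ "path_length p - i"]) auto
qed

lemma relpow_imp_down_up_path:
  assumes "s \<in> carrier L" and "(s, t) \<in> (coverings L)\<inverse> ^^ i O coverings L ^^ j"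
  shows "\<exists>p. down_up_path L s t p \<and> path_length p = i + j"
proof -
  from assms(2) obtain f g where
    f: "f 0 = s" "\<forall>k<i. covered_by L (f (Suc k)) (f k)" and
    g: "g 0 = f i" "g j = t" "\<forall>k<j. covered_by L (g k) (g (Suc k))"
    by (auto simp: relpow_fun_conv)
  \<comment> \<open>Both branches agree at the turning point \<open>k = i\<close>, since
    \<open>g 0 = f i\<close>.\<close>
  define h where "h k = (if k \<le> i then f k else g (k - i))" for k
  define p where "p = map h [0..<Suc (i + j)]"
  have len: "path_length p = i + j" by (simp add: p_def path_length_def)
  have nth: "p ! k = h k" if "k \<le> i + j" for k
    unfolding p_def using that by (subst nth_map) (auto simp del: upt_Suc)
  have down: "covered_by L (h (Suc k)) (h k)" if "k < i" for k
    using f that by (simp add: h_def)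
  have up: "covered_by L (h k) (h (Suc k))" if "i \<le> k" "k < i + j" for k
  proof -
    have "h k = g (k - i)" "h (Suc k) = g (Suc (k - i))"
      using that g(1) by (auto simp: h_def Suc_diff_le)
    then show ?thesis using g(3) that by simp
  qed
  \<comment> \<open>Only the start lies in the carrier by assumption; every later vertex does as an
    end of a covering.\<close>
  have carrier: "h k \<in> carrier L" if "k \<le> i + j" for k
  proof (cases k)
    case 0
    then show ?thesis using assms(1) f(1) by (simp add: h_def)
  next
    case (Suc m)
    then show ?thesis using down[of m] up[of m] that by (cases "m < i") (auto simp: covered_by_def)
  qed
  have "hasse_path L s t p"
    unfolding hasse_path_def len
  proof (intro conjI allI impI)
    show "p \<noteq> []" by (simp add: p_def)
    show "set p \<subseteq> carrier L" using carrier by (auto simp: p_def)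
    show "hd p = s" using f(1) by (simp add: p_def h_def hd_map del: upt_Suc)
    show "last p = t" using g(1,2) by (cases "j = 0") (simp_all add: p_def h_def)
    show "covered_by L (p ! k) (p ! Suc k) \<or> covered_by L (p ! Suc k) (p ! k)" if "k < i + j" for k
      using down[of k] up[of k] that by (cases "k < i") (simp_all add: nth)
  qed
  then have "down_up_path L s t p"
    unfolding down_up_path_def len
    by (intro conjI exI[of _ i]) (auto simp: nth down up)
  with len show ?thesis by blast
qed

section \<open>Distances and lower semimodularity\<close>

lemma poset_dist_le_down_up_dist: "poset_dist L s t \<le> down_up_dist L s t"
  unfolding poset_dist_def down_up_dist_def
  by (rule INF_superset_mono) (auto simp: down_up_path_def)

lemma down_up_dist_eq_poset_dist:
  assumes "lower_semimodular L" and "s \<in> carrier L"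
  shows "down_up_dist L s t = poset_dist L s t"
proof (rule antisym[OF _ poset_dist_le_down_up_dist])
  have exchange: "coverings L O (coverings L)\<inverse> \<subseteq> Id \<union> (coverings L)\<inverse> O coverings L"
  proof (rule subrelI)
    fix a b assume "(a, b) \<in> coverings L O (coverings L)\<inverse>"
    then obtain x where ax: "covered_by L a x" and bx: "covered_by L b x" by auto
    have "a \<noteq> b \<Longrightarrow> \<exists>y \<in> carrier L. covered_by L y a \<and> covered_by L y b"
      using assms(1) ax bx unfolding lower_semimodular_def by (meson covered_by_def)
    then show "(a, b) \<in> Id \<union> (coverings L)\<inverse> O coverings L" by blast
  qed
  show "down_up_dist L s t \<le> poset_dist L s t"
    unfolding poset_dist_def down_up_dist_def
  \<comment> \<open>Every path is matched with a down-up path that is no longer. This includes pairs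
    joined by no path, whose distance is \<open>\<infinity>\<close>.\<close>
  proof (rule INF_mono)
    fix p assume "p \<in> {p. hasse_path L s t p}"
    then obtain i j where ij: "i + j \<le> path_length p"
      "(s, t) \<in> (coverings L)\<inverse> ^^ i O coverings L ^^ j"
      using relpow_symcl_imp_down_up[OF exchange hasse_path_imp_relpow] by blast
    from relpow_imp_down_up_path[OF assms(2) ij(2)] ij(1)
    show "\<exists>q \<in> {q. down_up_path L s t q}. enat (path_length q) \<le> enat (path_length p)"
      by auto
  qed
qed

lemma (in partial_order) trancl_coverings_lless:
  assumes "(x, y) \<in> (coverings L)\<^sup>+"
  shows "x \<in> carrier L \<and> y \<in> carrier L \<and> x \<sqsubset> y"
  using assms
proof induction
  case (base y)
  then show ?case by (simp add: covered_by_def)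
next
  case (step y z)
  then show ?case by (auto simp: covered_by_def intro: lless_trans)
qed

text \<open>A chain of coverings up from \<open>s\<close> to \<open>t\<close> would put
  \<open>t\<close> strictly between \<open>s\<close> and \<open>x\<close>.\<close>

lemma (in partial_order) not_trancl_coverings:
  assumes "covered_by L s x" and "covered_by L t x"
  shows "(s, t) \<notin> (coverings L)\<^sup>+"
  using assms trancl_coverings_lless[of s t] by (auto simp: covered_by_def)

lemma (in partial_order) lower_semimodularI:
  assumes eq: "\<And>s t. s \<in> carrier L \<Longrightarrow> t \<in> carrier L \<Longrightarrow> down_up_dist L s t = poset_dist L s t"
  shows "lower_semimodular L"
  unfolding lower_semimodular_def
proof (intro ballI impI, elim conjE)
  fix s t x
  assume L: "s \<in> carrier L" "t \<in> carrier L" "x \<in> carrier L"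
    and sx: "covered_by L s x" and tx: "covered_by L t x" and "s \<noteq> t"
  have "hasse_path L s t [s, x, t]"
    using L sx tx by (auto simp: hasse_path_def path_length_def less_Suc_eq)
  then have "poset_dist L s t \<le> enat (path_length [s, x, t])"
    unfolding poset_dist_def by (intro INF_lower) simp
  \<comment> \<open>The strict bound lets \<open>INF_less_iff\<close> extract an actual path of
    length at most 2.\<close>
  also have "\<dots> < enat 3" by (simp add: path_length_def)
  finally have "down_up_dist L s t < enat 3" using eq L by simp
  then obtain p where p: "down_up_path L s t p" "path_length p < 3"
    unfolding down_up_dist_def INF_less_iff by auto
  then obtain i j where ij: "i + j < 3"
    and "(s, t) \<in> (coverings L)\<inverse> ^^ i O coverings L ^^ j"
    using down_up_path_imp_relpow[OF p(1)] p(2) by metis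
  then obtain y where down: "(s, y) \<in> (coverings L)\<inverse> ^^ i" and up: "(y, t) \<in> coverings L ^^ j"
    by blast
  have down': "(y, s) \<in> coverings L ^^ i"
    using down by (simp add: relpow_converse)
  \<comment> \<open>Without descents the path would climb from \<open>s\<close> to \<open>t\<close>;
    without ascents, read backwards, from \<open>t\<close> to \<open>s\<close>. Hence the path has
    one of each, and \<open>y\<close> is the bottom of the valley.\<close>
  have "i \<noteq> 0"
  proof
    assume "i = 0"
    with down up \<open>s \<noteq> t\<close> have "j \<noteq> 0" "(s, t) \<in> coverings L ^^ j" by (auto intro: gr0I)
    then have "(s, t) \<in> (coverings L)\<^sup>+" unfolding trancl_power by blast
    then show False using not_trancl_coverings[OF sx tx] by simp
  qed
  moreover have "j \<noteq> 0"
  proof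
    assume "j = 0"
    with up down' \<open>i \<noteq> 0\<close> have "(t, s) \<in> (coverings L)\<^sup>+" by (auto simp: trancl_power)
    then show False using not_trancl_coverings[OF tx sx] by simp
  qed
  ultimately have "i = 1" "j = 1" using ij by auto
  with down' up show "\<exists>y \<in> carrier L. covered_by L y s \<and> covered_by L y t"
    by (auto simp: covered_by_def)
qed

theorem (in partial_order) lower_semimodular_iff_down_up_dist:
  "lower_semimodular L \<longleftrightarrow>
    (\<forall>s \<in> carrier L. \<forall>t \<in> carrier L. down_up_dist L s t = poset_dist L s t)"
proof
  assume "lower_semimodular L"
  then show "\<forall>s \<in> carrier L. \<forall>t \<in> carrier L. down_up_dist L s t = poset_dist L s t"
    by (simp add: down_up_dist_eq_poset_dist)
qed (simp add: lower_semimodularI)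

section \<open>Duality\<close>

context partial_order
begin

text \<open>\<open>lless\<close> is defined by \<open>le\<close> and the negation of
  \<open>eq\<close>. Inversion flips only \<open>le\<close>, so \<open>eq_is_equal\<close> supplies
  the symmetry of the other conjunct.\<close>

lemma covered_by_inv: "covered_by (inv_gorder L) x y \<longleftrightarrow> covered_by L y x"
  by (auto simp: covered_by_def lless_def eq_is_equal)

lemma hasse_path_inv: "hasse_path (inv_gorder L) s t p \<longleftrightarrow> hasse_path L s t p"
  by (auto simp: hasse_path_def covered_by_inv)

lemma poset_dist_inv: "poset_dist (inv_gorder L) s t = poset_dist L s t"
  by (simp add: poset_dist_def hasse_path_inv)

text \<open>The list of vertices stays the same and is traversed in the same direction; only ascents
  and descents trade roles.\<close>

lemma down_up_dist_inv: "down_up_dist (inv_gorder L) s t = up_down_dist L s t"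
  by (simp add: down_up_dist_def up_down_dist_def down_up_path_def up_down_path_def
      hasse_path_inv covered_by_inv)

lemma lower_semimodular_inv: "lower_semimodular (inv_gorder L) \<longleftrightarrow> upper_semimodular L"
  by (simp add: lower_semimodular_def upper_semimodular_def covered_by_inv)

theorem upper_semimodular_iff_up_down_dist:
  "upper_semimodular L \<longleftrightarrow>
    (\<forall>s \<in> carrier L. \<forall>t \<in> carrier L. up_down_dist L s t = poset_dist L s t)"
  using partial_order.lower_semimodular_iff_down_up_dist[OF dual_order]
  by (simp add: poset_dist_inv down_up_dist_inv lower_semimodular_inv)

end

theorem theorem1:
  fixes V :: "'v set"
    and \<GG> :: "('v, 'k) lgraph set"
    and M :: "('v, 'k) lgraph \<Rightarrow> 'm set"
  assumes "finite V"
    and "finite \<GG>"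
    and "\<forall>G \<in> \<GG>. graph_over V G"
    and "inj_on M \<GG>"
  shows "((\<exists>b. least (model_poset \<GG> M) b (carrier (model_poset \<GG> M))) \<longrightarrow>
           (lower_semimodular (model_poset \<GG> M) \<longleftrightarrow>
             (\<forall>s \<in> \<GG>. \<forall>t \<in> \<GG>.
                down_up_dist (model_poset \<GG> M) s t = poset_dist (model_poset \<GG> M) s t)))
       \<and> ((\<exists>b. greatest (model_poset \<GG> M) b (carrier (model_poset \<GG> M))) \<longrightarrow>
           (upper_semimodular (model_poset \<GG> M) \<longleftrightarrow>
             (\<forall>s \<in> \<GG>. \<forall>t \<in> \<GG>.
                up_down_dist (model_poset \<GG> M) s t = poset_dist (model_poset \<GG> M) s t)))"
proof -
  \<comment> \<open>Injectivity of \<open>M\<close> is what makes inclusion of models antisymmetric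
    on graphs.\<close>
  interpret partial_order "model_poset \<GG> M"
    using assms(4) by (rule partial_order_model_poset)
  have carrier: "carrier (model_poset \<GG> M) = \<GG>" by (simp add: model_poset_def)
  show ?thesis
    using lower_semimodular_iff_down_up_dist upper_semimodular_iff_up_down_dist
    unfolding carrier by simp
qed

end
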